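(* Let $\mathbb{K}$ be an algebraically closed field of characteristic $0$ or of prime characteristic $p\ge 7$, and let $m\ge 5$ be an integer, with $m\le p-1$ if $\mathbb{K}$ has characteristic $p$. Let $V$ be the irreducible non-singular curve in $\mathrm{PG}(m-1,\mathbb{K})$ defined by $X_1^k+\cdots+X_m^k=0$ for $1\le k\le m-2$, let $G\cong\mathrm{Sym}_m$ act on $V$ by permuting the homogeneous coordinates, and let $H$ be the subgroup of $G$ fixing each of $X_m,X_{m-1},X_{m-2}$. Then the quotient curve $\mathcal{X}=V/H$, as a plane curve, has homogeneous equation $G_{m-2}(x,y,z)=0$, where $$G_{m-2}(x,y,z)=\sum_{\substack{i,j,k\ge 0\\ i+j+k=m-2}}x^iy^jz^k .$$
   Context: The quotient curve $\mathcal{X}=V/H$ is identified with the plane curve which is the image of $V$ under the projection $(x_1:\cdots:x_m)\mapsto (x_{m-2}:x_{m-1}:x_m)$ from the subspace $X_{m-2}=X_{m-1}=X_m=0$ (which is disjoint from $V$) to $\mathrm{PG}(2,\mathbb{K})$; this image is isomorphic to $V/H$. *)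

theory Defs
  imports
    "HOL-Computational_Algebra.Polynomial"
    "HOL-Algebra.Sym_Groups"
    "HOL-Algebra.Group_Action"
begin

text \<open>
  A point of \<open>PG(n - 1, K)\<close> is a class of proportional nonzero vectors. A vector
  \<open>(x 1, \<dots>, x n)\<close> is a function on \<^typ>\<open>nat\<close> that is zero outside \<open>{1..n}\<close>.
\<close>

definition proj_point :: "(nat \<Rightarrow> 'a::field) \<Rightarrow> (nat \<Rightarrow> 'a) set" where
  "proj_point x = {(\<lambda>i. c * x i) | c. c \<noteq> 0}"

definition PG :: "nat \<Rightarrow> (nat \<Rightarrow> 'a::field) set set" where
  "PG d = {proj_point x | x. (\<forall>i. i \<notin> {1..d + 1} \<longrightarrow> x i = 0) \<and> (\<exists>i. x i \<noteq> 0)}"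

definition curve_V :: "nat \<Rightarrow> (nat \<Rightarrow> 'a::field) set set" where
  "curve_V m = {P \<in> PG (m - 1). \<forall>x\<in>P. \<forall>k\<in>{1..m - 2}. (\<Sum>i=1..m. x i ^ k) = 0}"

text \<open>The inverse makes this a left action.\<close>

definition perm_action :: "(nat \<Rightarrow> nat) \<Rightarrow> (nat \<Rightarrow> 'a) set \<Rightarrow> (nat \<Rightarrow> 'a) set" where
  "perm_action \<sigma> P = (\<lambda>x. x \<circ> inv' \<sigma>) ` P"

definition subgroup_H :: "nat \<Rightarrow> (nat \<Rightarrow> nat) set" where
  "subgroup_H m = {\<sigma> \<in> carrier (sym_group m). \<forall>i\<in>{m - 2, m - 1, m}. \<sigma> i = i}"

definition quotient_VH :: "nat \<Rightarrow> (nat \<Rightarrow> 'a::field) set set set" where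
  "quotient_VH m = orbits (sym_group m \<lparr>carrier := subgroup_H m\<rparr>) (curve_V m) perm_action"

text \<open>
  The projection \<open>(x 1 : \<dots> : x m) \<mapsto> (x (m - 2) : x (m - 1) : x m)\<close>. On a point of the
  centre of projection it gives \<open>{\<lambda>_. 0}\<close>, which is not a point of the plane.
\<close>

definition projection :: "nat \<Rightarrow> (nat \<Rightarrow> 'a::field) set \<Rightarrow> (nat \<Rightarrow> 'a) set" where
  "projection m P = (\<lambda>x i. if i \<in> {1..3} then x (m - 3 + i) else 0) ` P"

text \<open>
  The map induced on orbits; it is meaningful on the orbits on which the projection is constant.
\<close>

definition quotient_map_plane :: "nat \<Rightarrow> (nat \<Rightarrow> 'a::field) set set \<Rightarrow> (nat \<Rightarrow> 'a) set" where
  "quotient_map_plane m B = the_elem (projection m ` B)"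

text \<open>
  The ring \<open>K[x, y, z]\<close> is \<open>K[x][y][z]\<close>: the outermost variable is \<open>z\<close>.
\<close>

type_synonym 'a poly3 = "'a poly poly poly"

definition var_x :: "'a::comm_ring_1 poly3" where "var_x = [:[:[:0, 1:]:]:]"
definition var_y :: "'a::comm_ring_1 poly3" where "var_y = [:[:0, 1:]:]"
definition var_z :: "'a::comm_ring_1 poly3" where "var_z = [:0, 1:]"

definition eval3 :: "'a::comm_ring_1 poly3 \<Rightarrow> 'a \<Rightarrow> 'a \<Rightarrow> 'a \<Rightarrow> 'a" where
  "eval3 F a b c = poly (poly (poly F [:[:c:]:]) [:b:]) a"

definition homogeneous3 :: "nat \<Rightarrow> 'a::comm_ring_1 poly3 \<Rightarrow> bool" where
  "homogeneous3 d F \<longleftrightarrow>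
     (\<forall>i j k. coeff (coeff (coeff F k) j) i \<noteq> 0 \<longrightarrow> i + j + k = d)"

definition vanishes_at :: "'a::field poly3 \<Rightarrow> (nat \<Rightarrow> 'a) set \<Rightarrow> bool" where
  "vanishes_at F P \<longleftrightarrow> (\<forall>v\<in>P. eval3 F (v 1) (v 2) (v 3) = 0)"

text \<open>
  \<open>F = 0\<close> is an equation of a plane curve, regarded as a variety, if its zeros are the
  points of the curve and \<open>F\<close> generates the ideal of the curve (so that, for instance, a proper
  power of an equation is not an equation).
\<close>

definition has_homogeneous_equation ::
  "(nat \<Rightarrow> 'a::field) set set \<Rightarrow> 'a poly3 \<Rightarrow> bool" where
  "has_homogeneous_equation C F \<longleftrightarrow>
     (\<exists>d. homogeneous3 d F) \<and>
     C = {P \<in> PG 2. vanishes_at F P} \<and>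
     (\<forall>F'. (\<forall>P\<in>C. vanishes_at F' P) \<longleftrightarrow> F dvd F')"

definition G_poly :: "nat \<Rightarrow> 'a::comm_ring_1 poly3" where
  "G_poly n = (\<Sum>(i, j, k) \<in> {(i, j, k). i + j + k = n}. var_x ^ i * var_y ^ j * var_z ^ k)"

end

theory Submission
  imports Defs
    "HOL-Computational_Algebra.Polynomial_FPS"
    "HOL-Combinatorics.Permutations"
begin

text \<open>
  By Newton's identities, a vector \<open>x\<close> represents a point of \<open>V\<close> iff
  \<open>(T - x 1) \<cdots> (T - x m) = T ^ m + a T + b\<close> for some \<open>a\<close> and \<open>b\<close>. Three prescribed roots
  \<open>u, v, w\<close>, counted with multiplicity, determine such a trinomial, because the difference of
  two of them is linear and divisible by a cubic. So the last three coordinates determine the others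
  up to order, and the orbits of \<open>H\<close> are the fibres of the projection. Three
  values \<open>u, v, w\<close> are roots of such a trinomial iff \<open>G_poly (m - 2)\<close> vanishes at them:
  \<open>(T - u) (T - v) G(u, v, T)\<close> is a trinomial of this form.

  A polynomial that vanishes on the curve is divided by \<open>G\<close>, which is monic in \<open>z\<close>. For
  every \<open>b \<noteq> 0\<close> and almost all \<open>a\<close> the polynomial \<open>G(a, b, T)\<close> has \<open>m - 2\<close> distinct roots,
  at which the remainder, of smaller degree, vanishes; hence the remainder is zero.
\<close>

section \<open>Power sums and trinomials\<close>

unbundle fps_syntax

text \<open>Comparing coefficients gives Newton's identities (k + 1) E_(k+1) = - (E_0 P_k + ... +
  E_k P_0). Passing from \<open>P\<close> to \<open>E\<close> divides by k + 1, hence the condition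
  \<open>char\<close>.\<close>

lemma fps_logderiv_coeffs_zero_iff:
  fixes E P :: "'a::field fps"
  assumes E0: "E $ 0 = 1" and deriv: "fps_deriv E = - (E * P)"
    and char: "\<And>k. k \<in> {1..n} \<Longrightarrow> of_nat k \<noteq> (0::'a)"
  shows "(\<forall>k<n. P $ k = 0) \<longleftrightarrow> (\<forall>k\<in>{1..n}. E $ k = 0)"
proof -
  have coeff: "of_nat (Suc k) * E $ Suc k = - (\<Sum>i\<le>k. E $ i * P $ (k - i))" for k
    using arg_cong[OF deriv, of "\<lambda>F. F $ k"]
    by (simp add: fps_mult_nth atLeast0AtMost)
  show ?thesis
  proof (intro iffI ballI allI impI)
    fix k assume P: "\<forall>k<n. P $ k = 0" and k: "k \<in> {1..n}"
    then obtain l where l: "k = Suc l" by (cases k) auto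
    have "(\<Sum>i\<le>l. E $ i * P $ (l - i)) = 0"
      using P k l by (intro sum.neutral) auto
    then show "E $ k = 0"
      using coeff[of l] char[OF k] l by (simp del: of_nat_Suc)
  next
    fix k assume E: "\<forall>k\<in>{1..n}. E $ k = 0" and k: "k < n"
    have "(\<Sum>i\<le>k. E $ i * P $ (k - i)) = (\<Sum>i\<in>{0}. E $ i * P $ (k - i))"
      using E k by (intro sum.mono_neutral_right) auto
    then show "P $ k = 0"
      using coeff[of k] E k E0 by simp
  qed
qed

text \<open>The logarithmic derivative is the sum of the terms -x_i / (1 - x_i X), which geometric
  series turn into power sums, shifted by one.\<close>

lemma fps_deriv_prod_linear:
  fixes x :: "'i \<Rightarrow> 'a::field"
  assumes "finite A"
  shows "fps_deriv (\<Prod>i\<in>A. 1 - fps_const (x i) * fps_X) =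
    - ((\<Prod>i\<in>A. 1 - fps_const (x i) * fps_X) * Abs_fps (\<lambda>k. \<Sum>i\<in>A. x i ^ Suc k))"
  using assms
proof (induction A rule: finite_induct)
  case empty
  show ?case by (simp add: fps_eq_iff)
next
  case (insert j A)
  let ?L = "1 - fps_const (x j) * fps_X" and ?E = "\<Prod>i\<in>A. 1 - fps_const (x i) * fps_X"
  let ?P = "Abs_fps (\<lambda>k. \<Sum>i\<in>A. x i ^ Suc k)" and ?Q = "Abs_fps (\<lambda>k. x j ^ Suc k)"
  have geom: "?L * ?Q = fps_const (x j)"
  proof (rule fps_ext)
    fix n show "(?L * ?Q) $ n = fps_const (x j) $ n"
      by (cases n) (simp_all add: left_diff_distrib mult.assoc)
  qed
  have split: "Abs_fps (\<lambda>k. \<Sum>i\<in>insert j A. x i ^ Suc k) = ?Q + ?P"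
    using insert.hyps by (simp add: fps_eq_iff)
  have "fps_deriv (?L * ?E) = ?L * (- (?E * ?P)) - fps_const (x j) * ?E"
    using insert.IH by (simp add: algebra_simps)
  \<comment> \<open>Writing \<open>x j\<close> as \<open>?L * ?Q\<close> by the geometric series
    brings out the common factor \<open>?L * ?E\<close>.\<close>
  also have "\<dots> = ?L * (- (?E * ?P)) - (?L * ?Q) * ?E"
    by (simp only: geom)
  also have "\<dots> = - (?L * ?E * (?Q + ?P))"
    by (simp only: minus_mult_right[symmetric] distrib_left mult_ac) simp
  finally show ?case
    using insert.hyps unfolding split by simp
qed

text \<open>Reversing the coefficients of the product of the T - x_i gives the product of the 1 -
  x_i X, whose logarithmic derivative is known.\<close>

lemma power_sums_zero_iff_coeffs:
  fixes x :: "'i \<Rightarrow> 'a::field"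
  assumes fin: "finite A" and n: "n \<le> card A"
    and char: "\<And>k. k \<in> {1..n} \<Longrightarrow> of_nat k \<noteq> (0::'a)"
  shows "(\<forall>k\<in>{1..n}. (\<Sum>i\<in>A. x i ^ k) = 0) \<longleftrightarrow>
    (\<forall>k\<in>{1..n}. coeff (\<Prod>i\<in>A. [:- x i, 1:]) (card A - k) = 0)"
proof -
  let ?f = "\<Prod>i\<in>A. [:- x i, 1:]" and ?E = "\<Prod>i\<in>A. 1 - fps_const (x i) * fps_X"
  have deg: "degree ?f = card A"
    by (subst degree_prod_eq_sum_degree) auto
  have lin: "reflect_poly [:- y, 1:] = [:1, - y:]" for y :: 'a
    by (cases "y = 0") (simp_all add: reflect_poly_def cCons_def)
  have "fps_of_poly (reflect_poly ?f) = ?E"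
    by (simp add: reflect_poly_prod fps_of_poly_prod lin fps_of_poly_linear' flip: fps_const_neg)
  then have nth: "?E $ k = (if k > card A then 0 else coeff ?f (card A - k))" for k
    using coeff_reflect_poly[of ?f k] deg by (metis fps_of_poly_nth)
  have E0: "?E $ 0 = 1"
    using nth[of 0] lead_coeff_prod[of "\<lambda>i. [:- x i, 1:]" A] deg by simp
  have "(\<forall>k\<in>{1..n}. (\<Sum>i\<in>A. x i ^ k) = 0) \<longleftrightarrow> (\<forall>k<n. (\<Sum>i\<in>A. x i ^ Suc k) = 0)"
    unfolding image_Suc_lessThan[of n, symmetric] by blast
  also have "\<dots> \<longleftrightarrow> (\<forall>k\<in>{1..n}. ?E $ k = 0)"
    using fps_logderiv_coeffs_zero_iff[OF E0 fps_deriv_prod_linear[OF fin] char] by simp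
  also have "\<dots> \<longleftrightarrow> (\<forall>k\<in>{1..n}. coeff ?f (card A - k) = 0)"
    using n by (simp add: nth)
  finally show ?thesis .
qed

lemma power_sums_zero_iff_trinomial:
  fixes x :: "'i \<Rightarrow> 'a::field"
  assumes fin: "finite A" and card: "card A \<ge> 2"
    and char: "\<And>k. k \<in> {1..card A - 2} \<Longrightarrow> of_nat k \<noteq> (0::'a)"
  shows "(\<forall>k\<in>{1..card A - 2}. (\<Sum>i\<in>A. x i ^ k) = 0) \<longleftrightarrow>
    (\<exists>a b. (\<Prod>i\<in>A. [:- x i, 1:]) = monom 1 (card A) + [:b, a:])"
proof -
  let ?f = "\<Prod>i\<in>A. [:- x i, 1:]"
  have deg: "degree ?f = card A"
    by (subst degree_prod_eq_sum_degree) auto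
  have lead: "coeff ?f (card A) = 1"
    using lead_coeff_prod[of "\<lambda>i. [:- x i, 1:]" A] deg by simp
  have lin: "coeff [:b, a:] k = (if k = 0 then b else if k = 1 then a else 0)" for a b :: 'a and k
    by (cases k) (auto simp: coeff_pCons split: nat.splits)
  have "(\<forall>k\<in>{1..card A - 2}. coeff ?f (card A - k) = 0) \<longleftrightarrow>
      (\<exists>a b. ?f = monom 1 (card A) + [:b, a:])" (is "?l \<longleftrightarrow> ?r")
  proof
    assume l: ?l
    have "coeff ?f k = coeff (monom 1 (card A) + [:coeff ?f 0, coeff ?f 1:]) k" for k
    proof -
      consider "k \<le> 1" | "2 \<le> k" "k < card A" | "k = card A" | "k > card A" by linarith
      then show ?thesis
      proof cases
        case 1
        with card show ?thesis by (auto simp: lin le_Suc_eq)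
      next
        case 2
        then have "coeff ?f (card A - (card A - k)) = 0"
          by (intro l[rule_format]) auto
        with 2 show ?thesis by (simp add: lin)
      next
        case 3
        with card lead show ?thesis by (simp add: lin)
      next
        case 4
        with deg card show ?thesis by (simp add: lin coeff_eq_0)
      qed
    qed
    then show ?r by (meson poly_eqI)
  next
    assume ?r
    then obtain a b where f: "?f = monom 1 (card A) + [:b, a:]" by blast
    show ?l
    proof
      fix k assume "k \<in> {1..card A - 2}"
      then have "card A - k \<noteq> card A" "card A - k \<ge> 2" using card by auto
      then show "coeff ?f (card A - k) = 0" by (simp add: f lin)
    qed
  qed
  then show ?thesis
    using power_sums_zero_iff_coeffs[OF fin diff_le_self char] by (rule trans[rotated])
qed

section \<open>Complete homogeneous polynomials\<close>

text \<open>The complete homogeneous symmetric polynomial h_n(a, b), over any commutative ring so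
  that the arguments may be polynomials.\<close>

definition chs2 :: "nat \<Rightarrow> 'a::comm_ring_1 \<Rightarrow> 'a \<Rightarrow> 'a" where
  "chs2 n a b = (\<Sum>i\<le>n. a ^ i * b ^ (n - i))"

text \<open>This is h_n(a, b, T) as a polynomial in T.\<close>

definition chs_poly :: "nat \<Rightarrow> 'a::comm_ring_1 \<Rightarrow> 'a \<Rightarrow> 'a poly" where
  "chs_poly n a b = (\<Sum>k\<le>n. monom (chs2 (n - k) a b) k)"

lemma chs2_0 [simp]: "chs2 0 a b = 1"
  by (simp add: chs2_def)

lemma chs2_Suc: "chs2 (Suc n) a b = b * chs2 n a b + a ^ Suc n"
  by (simp add: chs2_def sum_distrib_left Suc_diff_le mult_ac)

lemma chs2_Suc': "chs2 (Suc n) a b = a * chs2 n a b + b ^ Suc n"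
  by (simp add: chs2_def sum.atMost_Suc_shift sum_distrib_left mult_ac del: sum.atMost_Suc)

lemma chs2_Suc_Suc: "chs2 (Suc (Suc n)) a b = (a + b) * chs2 (Suc n) a b - a * b * chs2 n a b"
  using chs2_Suc[of "Suc n" a b] chs2_Suc[of n a b] by (simp add: algebra_simps)

lemma chs2_zero_left: "chs2 n 0 b = b ^ n"
  by (cases n) (simp_all add: chs2_Suc')

lemma poly_chs2: "poly (chs2 n p q) c = chs2 n (poly p c) (poly q c)"
  by (simp add: chs2_def poly_sum)

lemma chs2_scale: "chs2 n (t * a) (t * b) = t ^ n * chs2 n a b"
proof -
  have "(t * a) ^ i * (t * b) ^ (n - i) = t ^ n * (a ^ i * b ^ (n - i))" if "i \<le> n" for i
    using that power_add[of t i "n - i"] by (simp add: power_mult_distrib mult_ac)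
  then show ?thesis
    by (simp add: chs2_def sum_distrib_left)
qed

lemma coeff_chs_poly: "coeff (chs_poly n a b) k = (if k \<le> n then chs2 (n - k) a b else 0)"
  by (simp add: chs_poly_def coeff_sum)

lemma degree_chs_poly: "degree (chs_poly n a b) = n"
  by (intro antisym degree_le le_degree) (auto simp: coeff_chs_poly)

lemma chs_poly_nonzero: "chs_poly n a b \<noteq> 0"
  using coeff_chs_poly[of n a b n] by auto

lemma chs_poly_Suc: "chs_poly (Suc n) a b = [:chs2 (Suc n) a b:] + [:0, 1:] * chs_poly n a b"
  by (intro poly_eqI) (auto simp: coeff_chs_poly coeff_pCons split: nat.splits)

text \<open>Induction through h_(n+1)(a, b, T) = h_(n+1)(a, b) + T h_n(a, b, T): the terms in T^2
  cancel, and \<open>chs2_Suc_Suc\<close> gives the new linear coefficient.\<close>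

lemma linear_factors_mult_chs_poly:
  "[:- a, 1:] * [:- b, 1:] * chs_poly n a b =
    monom 1 (n + 2) + [:a * b * chs2 n a b, - chs2 (Suc n) a b:]"
proof (induction n)
  case 0
  show ?case
    by (intro poly_eqI)
      (auto simp: chs_poly_def chs2_Suc coeff_pCons monom_altdef numeral_2_eq_2 algebra_simps split: nat.splits)
next
  case (Suc n)
  have "[:- a, 1:] * [:- b, 1:] * chs_poly (Suc n) a b =
      [:0, 1:] * ([:- a, 1:] * [:- b, 1:] * chs_poly n a b) +
      [:- a, 1:] * [:- b, 1:] * [:chs2 (Suc n) a b:]"
    by (simp only: chs_poly_Suc) (simp add: algebra_simps)
  also have "\<dots> = monom 1 (Suc n + 2) +
      [:a * b * chs2 (Suc n) a b, - chs2 (Suc (Suc n)) a b:]"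
    unfolding Suc chs2_Suc_Suc
    by (simp add: algebra_simps monom_Suc)
  finally show ?case .
qed

lemma poly_chs_poly_scale:
  "poly (chs_poly n (t * a) (t * b)) (t * c) = t ^ n * poly (chs_poly n a b) c"
proof -
  have "t ^ (n - k) * x * (t ^ k * y) = t ^ n * (x * y)" if "k \<le> n" for k and x y :: 'a
    using that power_add[of t "n - k" k] by (simp add: mult_ac)
  then show ?thesis
    by (simp add: chs_poly_def poly_sum poly_monom chs2_scale power_mult_distrib sum_distrib_left)
qed

section \<open>The ideal generated by \<open>G_poly\<close>\<close>

text \<open>Over a finite field, 1 plus the product of all T - a would be nonconstant without a
  root.\<close>

lemma infinite_UNIV_alg_closed: "infinite (UNIV :: 'a::alg_closed_field set)"
proof
  assume fin: "finite (UNIV :: 'a set)"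
  let ?p = "1 + (\<Prod>a\<in>UNIV. [:- a, 1 :: 'a:])"
  have "poly ?p x = 1" for x
    using fin by (simp add: poly_prod)
  moreover have "degree (\<Prod>a\<in>UNIV. [:- a, 1 :: 'a:]) > 0"
    using fin by (subst degree_prod_eq_sum_degree) (auto simp: card_gt_0_iff)
  then have "degree ?p > 0"
    by (subst degree_add_eq_right) auto
  ultimately show False
    using alg_closed_imp_poly_has_root[of ?p] by auto
qed

text \<open>The polynomial splits, and without a squared linear factor its multiset of roots has no
  repetitions.\<close>

lemma alg_closed_card_roots:
  fixes p :: "'a::alg_closed_field poly"
  assumes p: "p \<noteq> 0" and simple: "\<And>z. \<not> [:- z, 1:] ^ 2 dvd p"
  shows "card {z. poly p z = 0} = degree p"
proof -
  obtain A where A: "size A = degree p" "p = smult (lead_coeff p) (\<Prod>x\<in>#A. [:- x, 1:])"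
    using alg_closed_imp_factorization[OF p] by blast
  have "proots p = proots (\<Prod>q\<in>#image_mset (\<lambda>x. [:- x, 1:]) A. q)"
    by (subst A(2)) (use p in simp)
  also have "\<dots> = A"
    by (subst proots_prod_mset) (auto simp: image_mset.compositionality o_def)
  finally have A_eq: "proots p = A" .
  have "count A z \<le> 1" for z
    using simple[of z] p unfolding A_eq[symmetric] by (auto simp: order_divides)
  then have "count A z = 1" if "z \<in># A" for z
    using that by (intro antisym) (auto simp: Suc_le_eq)
  then have "size A = card (set_mset A)"
    by (simp add: size_multiset_overloaded_eq)
  with A(1) show ?thesis
    using p by (simp flip: A_eq)
qed

text \<open>Collecting monomials by the power of z, the outermost variable, leaves h_(n-k)(x, y) as
  coefficient of z^k; \<open>[:[:0, 1:]:]\<close> is x and \<open>[:0, 1:]\<close> is y in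
  K[x][y].\<close>

lemma G_poly_eq_chs_poly: "G_poly n = chs_poly n [:[:0, 1:]:] [:0, 1:]"
proof -
  have "G_poly n = (\<Sum>(k, i)\<in>Sigma {..n} (\<lambda>k. {..n - k}). var_x ^ i * var_y ^ (n - k - i) * var_z ^ k :: 'a poly3)"
    unfolding G_poly_def
    by (rule sum.reindex_bij_witness[where i = "\<lambda>(k, i). (i, n - k - i, k)" and j = "\<lambda>(i, j, k). (k, i)"])
      auto
  also have "\<dots> = (\<Sum>k\<le>n. \<Sum>i\<le>n - k. var_x ^ i * var_y ^ (n - k - i) * var_z ^ k)"
    by (subst sum.Sigma) auto
  also have "\<dots> = (\<Sum>k\<le>n. [:chs2 (n - k) [:[:0, 1:]:] [:0, 1:]:] * var_z ^ k)"
  proof -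
    have "[:p ^ i * q ^ j:] = [:p:] ^ i * [:q:] ^ j" for p q :: "'a poly poly" and i j
      by (simp add: poly_const_pow)
    then have "[:chs2 l p q:] = (\<Sum>i\<le>l. [:p:] ^ i * [:q:] ^ (l - i))" for p q :: "'a poly poly" and l
      by (simp add: chs2_def flip: sum_to_poly)
    then show ?thesis
      by (simp add: var_x_def var_y_def sum_distrib_right)
  qed
  also have "\<dots> = chs_poly n [:[:0, 1:]:] [:0, 1:]"
    by (simp add: chs_poly_def monom_altdef var_z_def)
  finally show ?thesis .
qed

lemma homogeneous3_G_poly: "homogeneous3 n (G_poly n)"
proof -
  have zero: "coeff (coeff (chs2 l [:[:0, 1:]:] [:0, 1 :: 'a poly:]) j) i = 0"
    if "i + j \<noteq> l" for i j l
  proof -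
    have "[:[:0, 1 :: 'a:]:] ^ r * [:0, 1:] ^ (l - r) = monom (monom 1 r) (l - r)" for r
      by (simp add: monom_altdef poly_const_pow)
    then show ?thesis
      using that by (auto simp: chs2_def coeff_sum intro!: sum.neutral)
  qed
  show ?thesis
    unfolding homogeneous3_def
  proof (intro allI impI)
    fix i j k assume nz: "coeff (coeff (coeff (G_poly n :: 'a poly3) k) j) i \<noteq> 0"
    then have "k \<le> n"
      by (auto simp: G_poly_eq_chs_poly coeff_chs_poly split: if_splits)
    moreover from this nz zero[of i j "n - k"] have "i + j = n - k"
      by (auto simp: G_poly_eq_chs_poly coeff_chs_poly)
    ultimately show "i + j + k = n"
      by simp
  qed
qed

lemma eval3_mult: "eval3 (F * G) a b c = eval3 F a b c * eval3 G a b c"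
  by (simp add: eval3_def)

text \<open>Specializing x and y in the coefficients first leaves a polynomial in z alone, whose
  roots can be counted.\<close>

lemma eval3_eq_poly_map_poly:
  "eval3 F a b c = poly (map_poly (\<lambda>q. poly (poly q [:b:]) a) F) c"
  unfolding eval3_def by (induction F) (simp_all add: map_poly_pCons)

lemma map_poly_G_poly: "map_poly (\<lambda>q. poly (poly q [:b:]) a) (G_poly n) = chs_poly n a b"
  by (intro poly_eqI) (simp add: coeff_map_poly G_poly_eq_chs_poly coeff_chs_poly poly_chs2)

lemma eval3_G_poly: "eval3 (G_poly n) a b c = poly (chs_poly n a b) c"
  by (simp add: eval3_eq_poly_map_poly map_poly_G_poly)

text \<open>
  A multiple root of \<open>chs_poly n a b\<close> is a multiple root of the trinomial
  \<open>(T - a) (T - b) chs_poly n a b\<close>; the equation says that the discriminant of the latter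
  vanishes.
\<close>

lemma chs_poly_multiple_root:
  fixes a b :: "'a::field"
  assumes dvd: "[:- z, 1:] ^ 2 dvd chs_poly n a b"
  shows "(of_nat (n + 1) * chs2 (Suc n) a b) ^ (n + 1) * chs2 (Suc n) a b =
    of_nat (n + 2) ^ (n + 2) * (a * b * chs2 n a b) ^ (n + 1)"
proof -
  define \<alpha> \<beta> where "\<alpha> = chs2 (Suc n) a b" and "\<beta> = a * b * chs2 n a b"
  let ?f = "monom 1 (n + 2) + [:\<beta>, - \<alpha>:]"
  have "[:- z, 1:] ^ 2 dvd ?f"
    unfolding \<alpha>_def \<beta>_def linear_factors_mult_chs_poly[symmetric] using dvd by (rule dvd_mult)
  then obtain q where q: "?f = [:- z, 1:] ^ 2 * q" ..
  have f0: "z ^ (n + 2) - \<alpha> * z + \<beta> = 0"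
    using arg_cong[OF q, of "\<lambda>p. poly p z"] by (simp add: poly_monom algebra_simps)
  have "poly (pderiv ?f) z = 0"
    unfolding q by (simp add: pderiv_mult pderiv_power)
  then have f1: "of_nat (n + 2) * z ^ (n + 1) = \<alpha>"
    by (simp add: pderiv_add pderiv_monom poly_monom pderiv_pCons)
  \<comment> \<open>For the trinomial f this is z f'(z) - (n + 2) f(z), in which the power z^(n+2)
    cancels.\<close>
  have "of_nat (n + 1) * \<alpha> * z - of_nat (n + 2) * \<beta> =
      z * (\<alpha> * of_nat (n + 2) - \<alpha>) - of_nat (n + 2) * \<beta>"
    by (simp add: algebra_simps)
  also have "\<dots> = - (of_nat (n + 2) * (z ^ (n + 2) - \<alpha> * z + \<beta>)) + z * (of_nat (n + 2) * z ^ (n + 1) - \<alpha>)"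
    by (simp add: algebra_simps)
  also have "\<dots> = 0"
    by (simp only: f0 f1) simp
  finally have eq: "of_nat (n + 1) * \<alpha> * z = of_nat (n + 2) * \<beta>"
    by simp
  \<comment> \<open>One factor \<open>\<alpha>\<close> becomes (n + 2) z^(n+1); the linear relation
    \<open>eq\<close> then eliminates z without division.\<close>
  have "(of_nat (n + 1) * \<alpha>) ^ (n + 1) * \<alpha> = of_nat (n + 2) * (of_nat (n + 1) * \<alpha> * z) ^ (n + 1)"
    by (subst (2) f1[symmetric]) (simp only: power_mult_distrib mult_ac)
  also have "\<dots> = of_nat (n + 2) ^ (n + 2) * \<beta> ^ (n + 1)"
    unfolding eq by (simp add: power_mult_distrib)
  finally show ?thesis
    unfolding \<alpha>_def \<beta>_def .
qed

text \<open>For fixed \<open>b\<close> the relation of \<open>chs_poly_multiple_root\<close> is a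
  polynomial equation in \<open>a\<close>, written down by evaluating \<open>chs2\<close> at a
  variable; it is nontrivial.\<close>

lemma finite_chs_poly_multiple_root:
  fixes b :: "'a::field"
  assumes b: "b \<noteq> 0" and char: "of_nat (n + 1) \<noteq> (0::'a)"
  shows "finite {a. \<exists>z. [:- z, 1:] ^ 2 dvd chs_poly n a b}"
proof -
  let ?x = "[:0, 1 :: 'a:]" and ?b = "[:b:]"
  let ?D = "(of_nat (n + 1) * chs2 (Suc n) ?x ?b) ^ (n + 1) * chs2 (Suc n) ?x ?b -
    of_nat (n + 2) ^ (n + 2) * (?x * ?b * chs2 n ?x ?b) ^ (n + 1)"
  have D: "poly ?D a = (of_nat (n + 1) * chs2 (Suc n) a b) ^ (n + 1) * chs2 (Suc n) a b -
    of_nat (n + 2) ^ (n + 2) * (a * b * chs2 n a b) ^ (n + 1)" for a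
    by (simp add: poly_chs2 mult.assoc del: of_nat_Suc of_nat_add)
  \<comment> \<open>At \<open>a = 0\<close> the constant term of the trinomial is zero, and only \<open>(n + 1) ^ (n + 1) * b ^ ((n + 1) * (n + 2))\<close> remains.\<close>
  have "poly ?D 0 \<noteq> 0"
    unfolding D using b char by (simp add: chs2_zero_left del: of_nat_Suc of_nat_add)
  then have "finite {a. poly ?D a = 0}"
    by (intro poly_roots_finite) (metis poly_0)
  moreover have "{a. \<exists>z. [:- z, 1:] ^ 2 dvd chs_poly n a b} \<subseteq> {a. poly ?D a = 0}"
    using chs_poly_multiple_root unfolding D by auto
  ultimately show ?thesis
    by (rule finite_subset[rotated])
qed

section \<open>Division by \<open>G_poly\<close> and vanishing off finite sets\<close>

lemma poly_eq_0_if_zero_off_finite: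
  fixes p :: "'a::idom poly"
  assumes "infinite (UNIV :: 'a set)" "finite S" "\<And>a. a \<notin> S \<Longrightarrow> poly p a = 0"
  shows "p = 0"
proof (rule ccontr)
  assume "p \<noteq> 0"
  then have "finite (S \<union> {a. poly p a = 0})"
    using assms(2) poly_roots_finite by blast
  moreover have "S \<union> {a. poly p a = 0} = UNIV"
    using assms(3) by blast
  ultimately show False
    using assms(1) by simp
qed

text \<open>The constants \<open>[:b:]\<close> are infinitely many elements of the coefficient
  domain, and a nonzero polynomial has only finitely many roots there.\<close>

lemma poly_poly_eq_0_if_zero_off_finite:
  fixes p :: "'a::idom poly poly"
  assumes inf: "infinite (UNIV :: 'a set)" and fin: "finite S"
    and zero: "\<And>b. b \<notin> S \<Longrightarrow> poly p [:b:] = 0"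
  shows "p = 0"
proof (rule ccontr)
  assume "p \<noteq> 0"
  then have "finite {q. poly p q = 0}"
    by (rule poly_roots_finite)
  moreover have "(\<lambda>b. [:b:]) ` (- S) \<subseteq> {q. poly p q = 0}"
    using zero by auto
  ultimately have "finite ((\<lambda>b :: 'a. [:b:]) ` (- S))"
    by (rule finite_subset[rotated])
  then have "finite (- S)"
    by (rule finite_imageD) (auto intro: inj_onI)
  then show False
    using inf fin by (metis Compl_partition finite_UnI)
qed

text \<open>Restricting to \<open>b \<noteq> 0\<close> makes (a, b, c) a representative of a point
  of the plane and matches the range in which multiple roots occur for finitely many
  \<open>a\<close> only.\<close>

lemma G_poly_dvd_if_vanishing:
  fixes F :: "'a::alg_closed_field poly3"
  assumes char: "of_nat (n + 1) \<noteq> (0::'a)"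
    and zero: "\<And>a b c. b \<noteq> 0 \<Longrightarrow> poly (chs_poly n a b) c = 0 \<Longrightarrow> eval3 F a b c = 0"
  shows "G_poly n dvd F"
proof -
  let ?G = "G_poly n :: 'a poly3"
  let ?ev = "\<lambda>a b (q :: 'a poly poly). poly (poly q [:b:]) a"
  have G: "?G \<noteq> 0" "degree ?G = n" "coeff ?G n = 1"
    by (simp_all add: G_poly_eq_chs_poly chs_poly_nonzero degree_chs_poly coeff_chs_poly)
  \<comment> \<open>The coefficient ring K[x][y] is not a field, so pseudo-division is used; as
    \<open>?G\<close> is monic, its scaling factor is 1.\<close>
  obtain q r where "pseudo_divmod F ?G = (q, r)"
    by (cases "pseudo_divmod F ?G")
  from pseudo_divmod[OF G(1) this] G
  have F: "F = ?G * q + r" and deg: "r = 0 \<or> degree r < n"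
    by simp_all
  have inf: "infinite (UNIV :: 'a set)"
    by (rule infinite_UNIV_alg_closed)
  have r_zero: "map_poly (?ev a b) r = 0"
    if b: "b \<noteq> 0" and simple: "\<And>z. \<not> [:- z, 1:] ^ 2 dvd chs_poly n a b" for a b
  proof (rule ccontr)
    assume nz: "map_poly (?ev a b) r \<noteq> 0"
    have "eval3 r a b c = 0" if "poly (chs_poly n a b) c = 0" for c
      using zero[OF b that] that eval3_G_poly[of n a b c] by (simp add: F eval3_def)
    then have "{c. poly (chs_poly n a b) c = 0} \<subseteq> {c. poly (map_poly (?ev a b) r) c = 0}"
      by (auto simp: eval3_eq_poly_map_poly)
    then have "card {c. poly (chs_poly n a b) c = 0} \<le> card {c. poly (map_poly (?ev a b) r) c = 0}"
      using nz by (intro card_mono poly_roots_finite)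
    also have "\<dots> \<le> degree (map_poly (?ev a b) r)"
      using nz by (rule card_poly_roots_bound)
    also have "\<dots> \<le> degree r"
      by (intro degree_le) (simp add: coeff_map_poly coeff_eq_0)
    also have "\<dots> < n"
      using deg nz by auto
    finally show False
      using alg_closed_card_roots[OF chs_poly_nonzero simple] by (simp add: degree_chs_poly)
  qed
  \<comment> \<open>One variable at a time: in x for fixed \<open>b\<close>, off finitely many
    \<open>a\<close>, then in y, off b = 0.\<close>
  have "coeff r k = 0" for k
  proof (rule poly_poly_eq_0_if_zero_off_finite[OF inf, of "{0}"])
    fix b :: 'a assume b: "b \<notin> {0}"
    show "poly (coeff r k) [:b:] = 0"
    proof (rule poly_eq_0_if_zero_off_finite[OF inf finite_chs_poly_multiple_root])
      fix a assume "a \<notin> {a. \<exists>z. [:- z, 1:] ^ 2 dvd chs_poly n a b}"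
      with b have "map_poly (?ev a b) r = 0"
        by (intro r_zero) auto
      then have "coeff (map_poly (?ev a b) r) k = 0"
        by simp
      then show "?ev a b (coeff r k) = 0"
        by (simp add: coeff_map_poly)
    qed (use b char in auto)
  qed simp
  then have "r = 0"
    by (intro poly_eqI) simp
  with F show ?thesis
    by simp
qed

section \<open>The quotient curve\<close>

text \<open>These are the representatives of the points of V once 1, ..., m - 2 are nonzero in the
  field; the last condition replaces the power sums.\<close>

definition trinomial_vector :: "nat \<Rightarrow> (nat \<Rightarrow> 'a::field) \<Rightarrow> bool" where
  "trinomial_vector m x \<longleftrightarrow> (\<forall>i. i \<notin> {1..m} \<longrightarrow> x i = 0) \<and> (\<exists>i. x i \<noteq> 0) \<and>
    (\<exists>a b. (\<Prod>i=1..m. [:- x i, 1:]) = monom 1 m + [:b, a:])"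

definition last3 :: "nat \<Rightarrow> (nat \<Rightarrow> 'a::zero) \<Rightarrow> nat \<Rightarrow> 'a" where
  "last3 m x i = (if i \<in> {1..3} then x (m - 3 + i) else 0)"

section \<open>Points and their representatives\<close>

lemma self_in_proj_point: "x \<in> proj_point x"
  by (auto simp: proj_point_def intro!: exI[of _ 1])

lemma proj_point_scale:
  assumes "c \<noteq> 0"
  shows "proj_point (\<lambda>i. c * x i) = proj_point x"
proof (intro subset_antisym subsetI)
  show "y \<in> proj_point x" if "y \<in> proj_point (\<lambda>i. c * x i)" for y
  proof -
    from that obtain d where "d \<noteq> 0" "y = (\<lambda>i. d * (c * x i))"
      by (auto simp: proj_point_def)
    then show ?thesis
      using assms by (auto simp: proj_point_def mult.assoc intro!: exI[of _ "d * c"])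
  qed
  show "y \<in> proj_point (\<lambda>i. c * x i)" if "y \<in> proj_point x" for y
  proof -
    from that obtain d where "d \<noteq> 0" "y = (\<lambda>i. d * x i)"
      by (auto simp: proj_point_def)
    then show ?thesis
      using assms by (auto simp: proj_point_def intro!: exI[of _ "d / c"])
  qed
qed

lemma proj_point_in_PG_iff:
  "proj_point x \<in> PG d \<longleftrightarrow> (\<forall>i. i \<notin> {1..d + 1} \<longrightarrow> x i = 0) \<and> (\<exists>i. x i \<noteq> 0)"
proof
  assume "proj_point x \<in> PG d"
  then obtain y where y: "proj_point x = proj_point y" "\<forall>i. i \<notin> {1..d + 1} \<longrightarrow> y i = 0" "\<exists>i. y i \<noteq> 0"
    unfolding PG_def by blast
  obtain c where "c \<noteq> 0" "x = (\<lambda>i. c * y i)"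
    using self_in_proj_point[of x] unfolding y(1) by (auto simp: proj_point_def)
  then show "(\<forall>i. i \<notin> {1..d + 1} \<longrightarrow> x i = 0) \<and> (\<exists>i. x i \<noteq> 0)"
    using y by auto
qed (auto simp: PG_def)

lemma PG_E:
  assumes "P \<in> PG d"
  obtains x where "P = proj_point x"
  using assms by (auto simp: PG_def)

lemma projection_proj_point: "projection m (proj_point x) = proj_point (last3 m x)"
proof -
  have "(\<lambda>i. if i \<in> {1..3} then c * x (m - 3 + i) else 0) = (\<lambda>i. c * last3 m x i)" for c
    by (auto simp: last3_def)
  then show ?thesis
    unfolding projection_def proj_point_def setcompr_eq_image image_image by simp
qed

lemma perm_action_proj_point: "perm_action \<sigma> (proj_point x) = proj_point (x \<circ> inv' \<sigma>)"
  unfolding perm_action_def proj_point_def setcompr_eq_image image_image o_def by simp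

text \<open>The power sums are homogeneous, so one representative decides, and Newton's identities
  apply to it.\<close>

lemma proj_point_in_curve_V_iff:
  fixes x :: "nat \<Rightarrow> 'a::field"
  assumes m: "m \<ge> 2" and char: "\<And>k. k \<in> {1..m - 2} \<Longrightarrow> of_nat k \<noteq> (0::'a)"
  shows "proj_point x \<in> curve_V m \<longleftrightarrow> trinomial_vector m x"
proof -
  have "(\<forall>y\<in>proj_point x. \<forall>k\<in>{1..m - 2}. (\<Sum>i=1..m. y i ^ k) = 0) \<longleftrightarrow>
      (\<forall>k\<in>{1..m - 2}. (\<Sum>i=1..m. x i ^ k) = 0)"
  proof
    assume "\<forall>k\<in>{1..m - 2}. (\<Sum>i=1..m. x i ^ k) = 0"
    then show "\<forall>y\<in>proj_point x. \<forall>k\<in>{1..m - 2}. (\<Sum>i=1..m. y i ^ k) = 0"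
      by (auto simp: proj_point_def power_mult_distrib simp flip: sum_distrib_left)
  qed (use self_in_proj_point in blast)
  also have "\<dots> \<longleftrightarrow> (\<exists>a b. (\<Prod>i=1..m. [:- x i, 1:]) = monom 1 m + [:b, a:])"
    using power_sums_zero_iff_trinomial[of "{1..m}" x] m char by simp
  finally show ?thesis
    using m by (simp add: curve_V_def trinomial_vector_def proj_point_in_PG_iff)
qed

section \<open>Trinomials with prescribed factors\<close>

lemma prod_split_last3:
  fixes f :: "nat \<Rightarrow> 'a::comm_monoid_mult"
  assumes "m \<ge> 3"
  shows "(\<Prod>i=1..m. f i) = f (m - 2) * f (m - 1) * f m * (\<Prod>i=1..m - 3. f i)"
proof -
  obtain n where "m = Suc (Suc (Suc n))"
    using assms that[of "m - 3"] by simp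
  then show ?thesis
    by (simp add: prod.cl_ivl_Suc mult_ac)
qed

lemma mult_eq_linear_imp_zero:
  fixes p q :: "'a::idom poly"
  assumes "p * q = [:b, a:]" "degree p \<ge> 2"
  shows "q = 0"
proof (rule ccontr)
  assume "q \<noteq> 0"
  then have "degree p \<le> degree (p * q)"
    using assms(2) by (subst degree_mult_eq) auto
  also have "\<dots> \<le> 1"
    unfolding assms(1) by simp
  finally show False
    using assms(2) by simp
qed

text \<open>The monomials of degree m cancel in the difference, leaving a multiple of
  \<open>p\<close> of degree at most 1.\<close>

lemma trinomial_cofactor_unique:
  fixes p q r :: "'a::idom poly"
  assumes "p * q = monom 1 m + [:b, a:]" "p * r = monom 1 m + [:b', a':]" "degree p \<ge> 2"
  shows "q = r"
proof -
  have "p * (q - r) = [:b - b', a - a':]"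
    using assms(1,2) by (simp add: algebra_simps)
  then show ?thesis
    using mult_eq_linear_imp_zero assms(3) by fastforce
qed

text \<open>Both \<open>chs_poly n u v\<close> and (T - w) p complete (T - u) (T - v) to a
  trinomial, so they coincide.\<close>

lemma chs_poly_root_if_trinomial:
  fixes u v w :: "'a::idom"
  assumes "[:- u, 1:] * [:- v, 1:] * [:- w, 1:] * p = monom 1 (n + 2) + [:b, a:]"
  shows "poly (chs_poly n u v) w = 0"
proof -
  have "[:- u, 1:] * [:- v, 1:] * ([:- w, 1:] * p) = monom 1 (n + 2) + [:b, a:]"
    using assms by (simp only: mult.assoc)
  from trinomial_cofactor_unique[OF this linear_factors_mult_chs_poly]
  have "[:- w, 1:] * p = chs_poly n u v"
    by (simp add: degree_mult_eq del: mult_pCons_left mult_pCons_right)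
  then show ?thesis
    by (metis dvd_triv_left poly_eq_0_iff_dvd)
qed

text \<open>Dividing \<open>chs_poly n u v\<close> by T - w leaves a monic polynomial of degree n -
  1, whose roots are the missing entries.\<close>

lemma trinomial_if_chs_poly_root:
  fixes u v w :: "'a::alg_closed_field"
  assumes n: "n \<ge> 1" and root: "poly (chs_poly n u v) w = 0"
  obtains y :: "nat \<Rightarrow> 'a" and a b where
    "[:- u, 1:] * [:- v, 1:] * [:- w, 1:] * (\<Prod>i=1..n - 1. [:- y i, 1:]) = monom 1 (n + 2) + [:b, a:]"
proof -
  obtain q where q: "chs_poly n u v = [:- w, 1:] * q"
    using root by (auto simp: poly_eq_0_iff_dvd)
  have nz: "q \<noteq> 0"
    using chs_poly_nonzero[of n u v] q by auto
  have deg: "degree q = n - 1"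
    using degree_chs_poly[of n u v] nz unfolding q by (subst (asm) degree_mult_eq) auto
  have "lead_coeff (chs_poly n u v) = 1"
    by (simp add: degree_chs_poly coeff_chs_poly)
  then have lead: "lead_coeff q = 1"
    unfolding q lead_coeff_mult by simp
  obtain A where A: "size A = n - 1" "q = (\<Prod>x\<in>#A. [:- x, 1:])"
    using alg_closed_imp_factorization[OF nz] lead deg by auto
  obtain xs where xs: "mset xs = A"
    using ex_mset by blast
  have "q = (\<Prod>i<n - 1. [:- (xs ! i), 1:])"
    using A(1) unfolding A(2) xs[symmetric] mset_map[symmetric] prod_mset_prod_list prod.list_conv_set_nth
    by (simp add: atLeast0LessThan)
  also have "\<dots> = (\<Prod>i=1..n - 1. [:- (xs ! (i - 1)), 1:])"
    by (rule prod.reindex_bij_witness[of _ "\<lambda>i. i - 1" Suc]) auto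
  finally show thesis
    using that[of "\<lambda>i. xs ! (i - 1)"] linear_factors_mult_chs_poly[of u v n]
    unfolding q by (metis mult.assoc)
qed

lemma last3_eq_iff:
  "last3 m x = last3 m y \<longleftrightarrow> (\<forall>i\<in>{1..3}. x (m - 3 + i) = y (m - 3 + i))"
  by (auto simp: last3_def fun_eq_iff)

lemma last3_range:
  fixes m i :: nat
  assumes "m \<ge> 3" "i \<in> {1..m}" "i \<notin> {1..m - 3}"
  obtains j where "j \<in> {1..3}" "i = m - 3 + j"
  using assms by (intro that[of "i - (m - 3)"]) auto

lemma last3_eqD:
  assumes "m \<ge> 3" "last3 m x = last3 m y"
  shows "x (m - 2) = y (m - 2)" "x (m - 1) = y (m - 1)" "x m = y m"
proof -
  have "m - 3 + 1 = m - 2" "m - 3 + 2 = m - 1" "m - 3 + 3 = m"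
    using assms(1) by auto
  with assms(2) show "x (m - 2) = y (m - 2)" "x (m - 1) = y (m - 1)" "x m = y m"
    unfolding last3_eq_iff by (force simp: Ball_def dest: spec[of _ 1] spec[of _ 2] spec[of _ 3])+
qed

text \<open>The three common linear factors have a unique cofactor, so the remaining coordinates
  agree as multisets and a permutation matches them.\<close>

lemma trinomial_vector_same_last3:
  fixes x y :: "nat \<Rightarrow> 'a::field"
  assumes m: "m \<ge> 3" and x: "trinomial_vector m x" and y: "trinomial_vector m y"
    and eq: "last3 m x = last3 m y"
  obtains \<sigma> where "\<sigma> permutes {1..m - 3}" "y = x \<circ> inv' \<sigma>"
proof -
  let ?f = "\<lambda>z. \<Prod>i=1..m - 3. [:- z i, 1:]"
  let ?p = "[:- x (m - 2), 1:] * [:- x (m - 1), 1:] * [:- x m, 1:]"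
  obtain a b a' b' where "(\<Prod>i=1..m. [:- x i, 1:]) = monom 1 m + [:b, a:]"
    "(\<Prod>i=1..m. [:- y i, 1:]) = monom 1 m + [:b', a':]"
    using x y unfolding trinomial_vector_def by blast
  then have "?p * ?f x = monom 1 m + [:b, a:]" "?p * ?f y = monom 1 m + [:b', a':]"
    unfolding prod_split_last3[OF m] last3_eqD[OF m eq] .
  moreover have "2 \<le> degree ?p"
    by (simp add: degree_mult_eq del: mult_pCons_left mult_pCons_right)
  ultimately have "?f x = ?f y"
    by (rule trinomial_cofactor_unique)
  then have "proots (?f x) = proots (?f y)"
    by simp
  then have "image_mset x (mset_set {1..m - 3}) = image_mset y (mset_set {1..m - 3})"
    by (simp add: proots_prod sum_unfold_sum_mset flip: image_mset.compositionality)
  from image_mset_eq_implies_permutes[OF finite_atLeastAtMost this]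
  obtain p where p: "p permutes {1..m - 3}" and xy: "\<forall>i\<in>{1..m - 3}. x i = y (p i)" .
  have "y i = x (inv' p i)" for i
  proof (cases "i \<in> {1..m - 3}")
    case True
    then have "inv' p i \<in> {1..m - 3}"
      using permutes_inv[OF p] by (simp only: permutes_in_image)
    with xy have "x (inv' p i) = y (p (inv' p i))"
      by blast
    then show ?thesis
      using permutes_inverses(1)[OF p] by simp
  next
    case False
    then have inv: "inv' p i = i"
      using permutes_inv[OF p] by (simp add: permutes_def)
    \<comment> \<open>Either \<open>i\<close> is one of the last three indices, or both vectors
      vanish there.\<close>
    have "y i = x i"
    proof (cases "i \<in> {1..m}")
      case True
      then show ?thesis
        using last3_range[OF m True False] eq by (metis last3_eq_iff)
    next
      case False
      with x y show ?thesis
        by (simp add: trinomial_vector_def)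
    qed
    with inv show ?thesis
      by simp
  qed
  then show thesis
    using that[OF p] by (simp add: fun_eq_iff)
qed

text \<open>V misses the centre of projection: otherwise T^3 divides the trinomial, which must then
  be T^m, and all coordinates are zero.\<close>

lemma last3_trinomial_vector_nonzero:
  fixes x :: "nat \<Rightarrow> 'a::field"
  assumes m: "m \<ge> 3" and x: "trinomial_vector m x"
  shows "\<exists>i. last3 m x i \<noteq> 0"
proof (rule ccontr)
  assume "\<not> ?thesis"
  then have "last3 m x = last3 m (\<lambda>_. 0)"
    by (auto simp: last3_def fun_eq_iff)
  note zero = last3_eqD[OF m this]
  let ?f = "\<Prod>i=1..m - 3. [:- x i, 1:]" and ?p = "[:0, 1:] * [:0, 1:] * [:0, 1 :: 'a:]"
  obtain a b where "(\<Prod>i=1..m. [:- x i, 1:]) = monom 1 m + [:b, a:]"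
    using x unfolding trinomial_vector_def by blast
  then have eq: "?p * ?f = monom 1 m + [:b, a:]"
    unfolding prod_split_last3[OF m] zero by simp
  have p: "?p = monom 1 3"
    by (simp add: monom_altdef power3_eq_cube)
  have mon: "?p * monom 1 (m - 3) = monom 1 m + [:0, 0:]"
    unfolding p mult_monom using m by simp
  have "?f = monom 1 (m - 3)"
    by (rule trinomial_cofactor_unique[OF eq mon]) (simp add: p degree_monom_eq)
  then have prod_eq: "(\<Prod>i=1..m. [:- x i, 1:]) = monom 1 m"
    unfolding prod_split_last3[OF m] zero using mon by simp
  have "(\<Prod>i=1..m. x j - x i) = x j ^ m" for j
    using arg_cong[OF prod_eq, of "\<lambda>q. poly q (x j)"]
    by (simp add: poly_prod poly_monom)
  moreover have "(\<Prod>i=1..m. x j - x i) = 0" if "j \<in> {1..m}" for j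
    using that by (intro prod_zero) auto
  ultimately have "x j = 0" if "j \<in> {1..m}" for j
    using that by (metis power_not_zero)
  then show False
    using x unfolding trinomial_vector_def by blast
qed

section \<open>The action of H and the fibres of the projection\<close>

lemma trinomial_vector_permute:
  assumes \<sigma>: "\<sigma> permutes {1..m}" and x: "trinomial_vector m x"
  shows "trinomial_vector m (x \<circ> \<sigma>)"
proof -
  have "(\<Prod>i=1..m. [:- (x \<circ> \<sigma>) i, 1:]) = (\<Prod>i=1..m. [:- x i, 1:])"
    using prod.permute[OF \<sigma>, of "\<lambda>i. [:- x i, 1:]"] by (simp add: o_def)
  moreover have "\<exists>i. x (\<sigma> i) \<noteq> 0"
    using x permutes_surj[OF \<sigma>] by (metis surjD trinomial_vector_def)
  moreover have "x (\<sigma> i) = 0" if "i \<notin> {1..m}" for i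
    using that x permutes_not_in[OF \<sigma>] by (simp add: trinomial_vector_def)
  ultimately show ?thesis
    using x by (simp add: trinomial_vector_def)
qed

lemma subgroup_H_iff:
  assumes "m \<ge> 3"
  shows "\<sigma> \<in> subgroup_H m \<longleftrightarrow> \<sigma> permutes {1..m - 3}"
proof
  have three: "{m - 2, m - 1, m} = {1..m} - {1..m - 3}"
    using assms by auto
  show "\<sigma> permutes {1..m - 3}" if "\<sigma> \<in> subgroup_H m"
    using that unfolding subgroup_H_def three sym_group_def
    by (auto intro: permutes_superset)
  show "\<sigma> \<in> subgroup_H m" if "\<sigma> permutes {1..m - 3}"
    using permutes_subset[OF that, of "{1..m}"] permutes_not_in[OF that]
    unfolding subgroup_H_def three sym_group_def by auto
qed

text \<open>H moves only the first m - 3 coordinates, so it preserves the projection; the converse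
  rests on \<open>trinomial_vector_same_last3\<close>.\<close>

lemma orbit_eq_fibre:
  fixes P :: "(nat \<Rightarrow> 'a::field) set"
  assumes m: "m \<ge> 3" and char: "\<And>k. k \<in> {1..m - 2} \<Longrightarrow> of_nat k \<noteq> (0::'a)"
    and P: "P \<in> curve_V m"
  shows "orbit (sym_group m \<lparr>carrier := subgroup_H m\<rparr>) perm_action P =
    {Q \<in> curve_V m. projection m Q = projection m P}"
proof -
  have "m \<ge> 2"
    using m by simp
  note V = proj_point_in_curve_V_iff[OF this char]
  obtain x where x: "P = proj_point x"
    using P unfolding curve_V_def by (auto elim: PG_E)
  with P V have tx: "trinomial_vector m x"
    by simp
  have "orbit (sym_group m \<lparr>carrier := subgroup_H m\<rparr>) perm_action P =
      {proj_point (x \<circ> inv' \<sigma>) |\<sigma>. \<sigma> permutes {1..m - 3}}"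
    by (simp add: orbit_def x perm_action_proj_point subgroup_H_iff[OF m])
  also have "\<dots> = {Q \<in> curve_V m. projection m Q = projection m P}"
  proof (intro subset_antisym subsetI)
    fix Q assume "Q \<in> {proj_point (x \<circ> inv' \<sigma>) |\<sigma>. \<sigma> permutes {1..m - 3}}"
    then obtain \<sigma> where Q: "Q = proj_point (x \<circ> inv' \<sigma>)" and \<sigma>: "\<sigma> permutes {1..m - 3}"
      by blast
    note inv = permutes_inv[OF \<sigma>]
    have "trinomial_vector m (x \<circ> inv' \<sigma>)"
      by (rule trinomial_vector_permute[OF permutes_subset[OF inv] tx]) auto
    moreover have "last3 m (x \<circ> inv' \<sigma>) = last3 m x"
      using permutes_not_in[OF inv] by (simp add: last3_eq_iff)
    ultimately show "Q \<in> {Q \<in> curve_V m. projection m Q = projection m P}"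
      using V by (simp add: Q x projection_proj_point)
  next
    fix Q assume "Q \<in> {Q \<in> curve_V m. projection m Q = projection m P}"
    then have Q: "Q \<in> curve_V m" "projection m Q = projection m P"
      by auto
    obtain y where y: "Q = proj_point y"
      using Q(1) unfolding curve_V_def by (auto elim: PG_E)
    have "last3 m x \<in> proj_point (last3 m y)"
      using self_in_proj_point Q(2) by (simp add: x y projection_proj_point)
    then obtain c where c: "c \<noteq> 0" "last3 m x = (\<lambda>i. c * last3 m y i)"
      by (auto simp: proj_point_def)
    \<comment> \<open>Rescaling the representative of \<open>Q\<close> turns proportional last
      coordinates into equal ones.\<close>
    let ?y = "\<lambda>i. c * y i"
    have Qy: "Q = proj_point ?y"
      using y c(1) by (simp add: proj_point_scale)
    have "last3 m x = last3 m ?y"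
      using c(2) by (auto simp: last3_def)
    moreover have "trinomial_vector m ?y"
      using Q(1) V unfolding Qy by simp
    ultimately obtain \<sigma> where "\<sigma> permutes {1..m - 3}" "?y = x \<circ> inv' \<sigma>"
      using trinomial_vector_same_last3[OF m tx] by metis
    then show "Q \<in> {proj_point (x \<circ> inv' \<sigma>) |\<sigma>. \<sigma> permutes {1..m - 3}}"
      unfolding Qy by auto
  qed
  finally show ?thesis .
qed

lemma vanishes_at_G_poly_iff:
  "vanishes_at (G_poly n) (proj_point v) \<longleftrightarrow> poly (chs_poly n (v 1) (v 2)) (v 3) = 0"
  by (auto simp: vanishes_at_def eval3_G_poly proj_point_def poly_chs_poly_scale intro!: exI[of _ 1])

text \<open>The inclusions are the two directions of the criterion for three elements to be roots of
  a trinomial; images are points of the plane because V misses the centre.\<close>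

lemma projection_curve_V:
  fixes m :: nat
  assumes m: "m \<ge> 3" and char: "\<And>k. k \<in> {1..m - 2} \<Longrightarrow> of_nat k \<noteq> (0::'a::alg_closed_field)"
  shows "projection m ` curve_V m = {P \<in> PG 2. vanishes_at (G_poly (m - 2) :: 'a poly3) P}"
proof (intro subset_antisym subsetI)
  have m2: "m \<ge> 2"
    using m by simp
  note V = proj_point_in_curve_V_iff[OF this char]
  have idx: "m - 3 + 1 = m - 2" "m - 3 + 2 = m - 1" "m - 3 + 3 = m"
    "m - 2 + 2 = m" "m - 2 - 1 = m - 3"
    using m by auto
  have last3: "last3 m x 1 = x (m - 2)" "last3 m x 2 = x (m - 1)" "last3 m x 3 = x m"
    for x :: "nat \<Rightarrow> 'a"
    unfolding last3_def idx by simp_all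
  fix R :: "(nat \<Rightarrow> 'a) set"
  {
    assume "R \<in> projection m ` curve_V m"
    then obtain P where P: "P \<in> curve_V m" "R = projection m P"
      by blast
    then obtain x where x: "P = proj_point x"
      unfolding curve_V_def by (auto elim: PG_E)
    with P V have tx: "trinomial_vector m x"
      by simp
    then obtain a b where "(\<Prod>i=1..m. [:- x i, 1:]) = monom 1 m + [:b, a:]"
      unfolding trinomial_vector_def by blast
    then have "poly (chs_poly (m - 2) (x (m - 2)) (x (m - 1))) (x m) = 0"
      unfolding prod_split_last3[OF m]
      by (rule chs_poly_root_if_trinomial[where n = "m - 2", unfolded idx])
    moreover have "proj_point (last3 m x) \<in> PG 2"
      unfolding proj_point_in_PG_iff
      using last3_trinomial_vector_nonzero[OF m tx] by (simp add: last3_def)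
    ultimately show "R \<in> {P \<in> PG 2. vanishes_at (G_poly (m - 2)) P}"
      unfolding P(2) x projection_proj_point mem_Collect_eq vanishes_at_G_poly_iff last3 by simp
  next
    assume R: "R \<in> {P \<in> PG 2. vanishes_at (G_poly (m - 2)) P}"
    then obtain v where v: "R = proj_point v"
      by (auto elim: PG_E)
    from R have supp: "v i = 0" if "i \<notin> {1..3}" for i
      using that unfolding v mem_Collect_eq proj_point_in_PG_iff by simp
    from R have nz: "\<exists>i. v i \<noteq> 0"
      unfolding v mem_Collect_eq proj_point_in_PG_iff by simp
    from R have root: "poly (chs_poly (m - 2) (v 1) (v 2)) (v 3) = 0"
      unfolding v mem_Collect_eq vanishes_at_G_poly_iff by simp
    have "m - 2 \<ge> 1"
      using m by linarith
    from trinomial_if_chs_poly_root[OF this root] obtain y :: "nat \<Rightarrow> 'a" and a b where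
      y: "[:- v 1, 1:] * [:- v 2, 1:] * [:- v 3, 1:] * (\<Prod>i=1..m - 3. [:- y i, 1:]) =
        monom 1 m + [:b, a:]"
      unfolding idx .
    \<comment> \<open>The roots \<open>y\<close> fill the first m - 3 places and \<open>v\<close>
      the last three. For i > m the index i - (m - 3) exceeds 3, where \<open>v\<close>
      vanishes.\<close>
    define x where "x i = (if i \<in> {1..m - 3} then y i else if i = 0 then 0 else v (i - (m - 3)))" for i
    have x_last: "x (m - 3 + i) = v i" if "i \<in> {1..3}" for i
      using that by (simp add: x_def)
    have "last3 m x = v"
      using supp x_last by (auto simp: last3_def)
    moreover have "trinomial_vector m x"
      unfolding trinomial_vector_def
    proof (intro conjI)
      show "\<forall>i. i \<notin> {1..m} \<longrightarrow> x i = 0"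
      proof (intro allI impI)
        fix i assume i: "i \<notin> {1..m}"
        with m have "i - (m - 3) \<notin> {1..3}" if "i \<noteq> 0"
          using that by auto
        with i show "x i = 0"
          using supp[of "i - (m - 3)"] by (auto simp: x_def)
      qed
      obtain i where "v i \<noteq> 0"
        using nz ..
      then show "\<exists>i. x i \<noteq> 0"
        using x_last supp by metis
      have "(\<Prod>i=1..m - 3. [:- x i, 1:]) = (\<Prod>i=1..m - 3. [:- y i, 1:])"
        by (intro prod.cong) (simp_all add: x_def)
      moreover have "x (m - 2) = v 1" "x (m - 1) = v 2" "x m = v 3"
        using x_last[of 1] x_last[of 2] x_last[of 3] unfolding idx by auto
      ultimately have "(\<Prod>i=1..m. [:- x i, 1:]) = monom 1 m + [:b, a:]"
        using y unfolding prod_split_last3[OF m] by (simp only:)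
      then show "\<exists>a b. (\<Prod>i=1..m. [:- x i, 1:]) = monom 1 m + [:b, a:]"
        by blast
    qed
    ultimately show "R \<in> projection m ` curve_V m"
      using V unfolding v by (metis image_eqI projection_proj_point)
  }
qed

text \<open>That n + 1 is nonzero in the field keeps the discriminant from vanishing identically, as
  the division argument requires.\<close>

lemma G_poly_homogeneous_equation:
  fixes n :: nat
  assumes char: "of_nat (n + 1) \<noteq> (0::'a::alg_closed_field)"
  shows "has_homogeneous_equation {P \<in> PG 2. vanishes_at (G_poly n :: 'a poly3) P} (G_poly n)"
  unfolding has_homogeneous_equation_def
proof (intro conjI allI iffI refl)
  show "\<exists>d. homogeneous3 d (G_poly n :: 'a poly3)"
    using homogeneous3_G_poly by blast
next
  fix F :: "'a poly3"
  assume F: "\<forall>P\<in>{P \<in> PG 2. vanishes_at (G_poly n) P}. vanishes_at F P"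
  show "G_poly n dvd F"
  proof (rule G_poly_dvd_if_vanishing[OF char])
    fix a b c :: 'a
    assume b: "b \<noteq> 0" and root: "poly (chs_poly n a b) c = 0"
    let ?v = "\<lambda>i :: nat. if i = 1 then a else if i = 2 then b else if i = 3 then c else 0"
    have "proj_point ?v \<in> PG 2"
      unfolding proj_point_in_PG_iff using b by (auto intro!: exI[of _ 2])
    moreover have "vanishes_at (G_poly n) (proj_point ?v)"
      unfolding vanishes_at_G_poly_iff using root by simp
    ultimately have "vanishes_at F (proj_point ?v)"
      using F by blast
    then show "eval3 F a b c = 0"
      using self_in_proj_point[of ?v] unfolding vanishes_at_def by fastforce
  qed
next
  fix F :: "'a poly3"
  assume "G_poly n dvd F"
  then show "\<forall>P\<in>{P \<in> PG 2. vanishes_at (G_poly n) P}. vanishes_at F P"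
    by (auto simp: vanishes_at_def eval3_mult)
qed

text \<open>The first conjunct makes \<open>quotient_map_plane\<close> meaningful on every orbit;
  with the next two it identifies the set of orbits with the projected curve.\<close>

theorem theorem6p4:
  fixes m :: nat
    and \<X> :: "(nat \<Rightarrow> 'a::alg_closed_field) set set"
  assumes char: "CHAR('a) = 0 \<or> (prime CHAR('a) \<and> CHAR('a) \<ge> 7)"
    and m: "m \<ge> 5"
    and m_char: "CHAR('a) \<noteq> 0 \<longrightarrow> m \<le> CHAR('a) - 1"
    and X: "\<X> = quotient_map_plane m ` quotient_VH m"
  shows "(\<forall>B\<in>quotient_VH m. \<forall>P\<in>B. projection m P = (quotient_map_plane m B :: (nat \<Rightarrow> 'a) set)) \<and>
    inj_on (quotient_map_plane m :: (nat \<Rightarrow> 'a) set set \<Rightarrow> _) (quotient_VH m) \<and>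
    \<X> = projection m ` curve_V m \<and>
    has_homogeneous_equation \<X> (G_poly (m - 2))"
proof -
  \<comment> \<open>In characteristic p > 0, k is positive and less than p, hence not divisible by
    p.\<close>
  have of_nat: "of_nat k \<noteq> (0::'a)" if "k \<in> {1..m}" for k
    using that m_char by (auto simp: of_nat_eq_0_iff_char_dvd dest: dvd_imp_le)
  have m3: "m \<ge> 3"
    using m by simp
  let ?fibre = "\<lambda>P :: (nat \<Rightarrow> 'a) set. {Q \<in> curve_V m. projection m Q = projection m P}"
  \<comment> \<open>Since orbits are fibres, the induced map is constant on each and separates
    them.\<close>
  have orbits: "quotient_VH m = ?fibre ` curve_V m"
    unfolding quotient_VH_def orbits_def setcompr_eq_image
    by (intro image_cong refl orbit_eq_fibre[OF m3 of_nat]) auto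
  have map: "quotient_map_plane m (?fibre P) = projection m P" if "P \<in> curve_V m" for P
  proof -
    have "projection m ` ?fibre P = {projection m P}"
      using that by auto
    then show ?thesis
      by (simp add: quotient_map_plane_def)
  qed
  have const: "\<forall>B\<in>quotient_VH m. \<forall>P\<in>B. projection m P = (quotient_map_plane m B :: (nat \<Rightarrow> 'a) set)"
    unfolding orbits using map by auto
  have inj: "inj_on (quotient_map_plane m :: (nat \<Rightarrow> 'a) set set \<Rightarrow> _) (quotient_VH m)"
    unfolding orbits using map by (auto intro!: inj_onI)
  have image: "\<X> = projection m ` curve_V m"
    unfolding X orbits image_image using map by (intro image_cong) auto
  moreover have "has_homogeneous_equation \<X> (G_poly (m - 2))"
  proof -
    have "\<X> = {P \<in> PG 2. vanishes_at (G_poly (m - 2)) P}"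
      unfolding image by (rule projection_curve_V[OF m3 of_nat]) auto
    moreover have "of_nat (m - 2 + 1) \<noteq> (0::'a)"
      using m by (intro of_nat) auto
    ultimately show ?thesis
      using G_poly_homogeneous_equation by simp
  qed
  ultimately show ?thesis
    using const inj by blast
qed

end
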